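(* For any $\bar w,\bar z\in\{0,1\}^{\mathcal T}$, the set of extreme points of the polytope $P(\bar w,\bar z)$ is equal to the set of critical points of $Q(\bar w,\bar z)$.
   Context: Let $T\ge1$, $\mathcal T=\{1,\dots,T\}$, finite nonnegative reals $L^s_t,U^s_t,L^x_t,U^x_t,L^y_t,U^y_t$ ($t\in\mathcal T$) and a given initial stock $s_0$. For $\bar w,\bar z\in\{0,1\}^{\mathcal T}$ set $(L'^x_t,U'^x_t)=(L^x_t,U^x_t)$ if $\bar w_t=1$ and $(0,0)$ otherwise; $(L'^y_t,U'^y_t)=(L^y_t,U^y_t)$ if $\bar z_t=1$ and $(0,0)$ otherwise. $Q(\bar w,\bar z)$ is the set of $(x,y,s)\in(\mathbb R^{\mathcal T})^3$ such that for all $t$: $s_t=s_{t-1}-y_t+x_t$, $x_ty_t=0$, $L^s_t\le s_t\le U^s_t$, $L'^y_t\le y_t\le U'^y_t$, $L'^x_t\le x_t\le U'^x_t$; $P(\bar w,\bar z)=\mathrm{conv}(Q(\bar w,\bar z))$. For $p=(x,y,s)\in Q(\bar w,\bar z)$, the stock-extreme time periods are $ET(p)=\{0\}\cup\{t\in\mathcal T: s_t\in\{L^s_t,U^s_t\}\}=\{0,t_1,\dots,t_n\}$ with $0<t_1<\dots<t_n$; the stock-extreme intervals of $p$ are the sets of integer time periods $(t_{i-1},t_i]=\{t_{i-1}+1,\dots,t_i\}$ for $i=1,\dots,n$ (with $t_0=0$), and the last interval is $(t_n,T]=\{t_n+1,\dots,T\}$. The sub-extreme time periods are $ST(p)=\{t: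 L'^y_t<y_t<U'^y_t\}\cup\{t: L'^x_t<x_t<U'^x_t\}$. A point $p\in Q(\bar w,\bar z)$ is a critical point if $|ST(p)\cap I|\le1$ for every stock-extreme interval $I$ of $p$ and $ST(p)\cap J=\emptyset$ for the last interval $J$ of $p$. *)

theory Defs
  imports "HOL-Analysis.Analysis" "HOL-Analysis.Finite_Function_Topology"
begin

text \<open>
  The coordinate space indexed by \<open>{1..T}\<close> is the subspace of the real vector space
  \<^typ>\<open>nat \<Rightarrow>\<^sub>0 real\<close> of vectors supported on \<open>{1..T}\<close>, so that the
  horizon can stay an ordinary natural number.  Values of the parameters outside \<open>{1..T}\<close>
  are never used.
\<close>

type_synonym rvec = "nat \<Rightarrow>\<^sub>0 real"

abbreviation entry :: "rvec \<Rightarrow> nat \<Rightarrow> real" (infixl \<open>\<cdot>\<close> 100) where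
  "v \<cdot> t \<equiv> Poly_Mapping.lookup v t"

definition period_space :: "nat \<Rightarrow> rvec set" where
  "period_space T = {v. Poly_Mapping.keys v \<subseteq> {1..T}}"

record stock_data =
  horizon :: nat
  init_stock :: real
  Ls :: "nat \<Rightarrow> real"
  Us :: "nat \<Rightarrow> real"
  Lx :: "nat \<Rightarrow> real"
  Ux :: "nat \<Rightarrow> real"
  Ly :: "nat \<Rightarrow> real"
  Uy :: "nat \<Rightarrow> real"

definition periods :: "stock_data \<Rightarrow> nat set" where
  "periods D = {1..horizon D}"

definition switched :: "(nat \<Rightarrow> nat) \<Rightarrow> (nat \<Rightarrow> real) \<Rightarrow> nat \<Rightarrow> real" where
  "switched w B t = (if w t = 1 then B t else 0)"

definition stock :: "stock_data \<Rightarrow> rvec \<Rightarrow> nat \<Rightarrow> real" where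
  "stock D s t = (if t = 0 then init_stock D else s \<cdot> t)"

definition Q :: "stock_data \<Rightarrow> (nat \<Rightarrow> nat) \<Rightarrow> (nat \<Rightarrow> nat) \<Rightarrow> (rvec \<times> rvec \<times> rvec) set" where
  "Q D w z = {(x, y, s).
     x \<in> period_space (horizon D) \<and> y \<in> period_space (horizon D) \<and> s \<in> period_space (horizon D) \<and>
     (\<forall>t\<in>periods D.
        stock D s t = stock D s (t - 1) - y \<cdot> t + x \<cdot> t \<and>
        x \<cdot> t * y \<cdot> t = 0 \<and>
        Ls D t \<le> s \<cdot> t \<and> s \<cdot> t \<le> Us D t \<and>
        switched z (Ly D) t \<le> y \<cdot> t \<and> y \<cdot> t \<le> switched z (Uy D) t \<and>
        switched w (Lx D) t \<le> x \<cdot> t \<and> x \<cdot> t \<le> switched w (Ux D) t)}"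

definition P :: "stock_data \<Rightarrow> (nat \<Rightarrow> nat) \<Rightarrow> (nat \<Rightarrow> nat) \<Rightarrow> (rvec \<times> rvec \<times> rvec) set" where
  "P D w z = convex hull (Q D w z)"

definition extreme_periods :: "stock_data \<Rightarrow> rvec \<times> rvec \<times> rvec \<Rightarrow> nat set" where
  "extreme_periods D = (\<lambda>(x, y, s). {0} \<union> {t \<in> periods D. s \<cdot> t \<in> {Ls D t, Us D t}})"

definition extreme_period_list :: "stock_data \<Rightarrow> rvec \<times> rvec \<times> rvec \<Rightarrow> nat list" where
  "extreme_period_list D p = sorted_list_of_set (extreme_periods D p)"

definition extreme_intervals :: "stock_data \<Rightarrow> rvec \<times> rvec \<times> rvec \<Rightarrow> nat set set" where
  "extreme_intervals D p =
     (let ts = extreme_period_list D p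
      in {{ts ! (i - 1)<..ts ! i} | i. 1 \<le> i \<and> i < length ts})"

definition last_interval :: "stock_data \<Rightarrow> rvec \<times> rvec \<times> rvec \<Rightarrow> nat set" where
  "last_interval D p = {last (extreme_period_list D p)<..horizon D}"

definition subextreme_periods ::
  "stock_data \<Rightarrow> (nat \<Rightarrow> nat) \<Rightarrow> (nat \<Rightarrow> nat) \<Rightarrow> rvec \<times> rvec \<times> rvec \<Rightarrow> nat set" where
  "subextreme_periods D w z = (\<lambda>(x, y, s).
     {t \<in> periods D. switched z (Ly D) t < y \<cdot> t \<and> y \<cdot> t < switched z (Uy D) t} \<union>
     {t \<in> periods D. switched w (Lx D) t < x \<cdot> t \<and> x \<cdot> t < switched w (Ux D) t})"

definition critical_points ::
  "stock_data \<Rightarrow> (nat \<Rightarrow> nat) \<Rightarrow> (nat \<Rightarrow> nat) \<Rightarrow> (rvec \<times> rvec \<times> rvec) set" where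
  "critical_points D w z = {p \<in> Q D w z.
     (\<forall>I\<in>extreme_intervals D p. card (subextreme_periods D w z p \<inter> I) \<le> 1) \<and>
     subextreme_periods D w z p \<inter> last_interval D p = {}}"

end

theory Submission
  imports Defs
begin

text \<open>
  Criticality says that any two sub-extreme periods are separated by a stock-extreme period and
  that every sub-extreme period is followed by one.  If this fails, a small amount of stock can
  be shifted, in either direction, from one sub-extreme period to the next one (or to the end of
  the horizon), so the point is the midpoint of two other points of \<open>Q\<close>.
  Conversely, let a critical point lie strictly between two points \<open>a\<close> and \<open>b\<close>.  These agree in
  \<open>x\<close> and \<open>y\<close> at all periods that are not sub-extreme and in the stock at all stock-extreme
  periods, so the first period in which their net flows differed would produce a stock difference
  that persists up to the next stock-extreme period.  Equal net flows force equal \<open>x\<close> and \<open>y\<close>,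
  since one of the two vanishes at the critical point and is nonnegative at \<open>a\<close> and \<open>b\<close>.
  This half never uses the complementarity \<open>x\<^sub>t y\<^sub>t = 0\<close> of \<open>a\<close> and \<open>b\<close>, hence it can be carried
  out in the convex relaxation of \<open>Q\<close> that drops this constraint.
\<close>

section \<open>Coordinates of vectors over the horizon\<close>

lemma lookup_scaleR: "(c *\<^sub>R v) \<cdot> t = c * v \<cdot> t"
  by (simp add: scaleR_poly_mapping_def)

lemma period_space_iff: "v \<in> period_space T \<longleftrightarrow> (\<forall>t. t \<notin> {1..T} \<longrightarrow> v \<cdot> t = 0)"
  unfolding period_space_def by (auto simp: in_keys_iff subset_iff)

lemma ex_vector_with_entries:
  fixes f :: "nat \<Rightarrow> real"
  assumes "\<And>t. t \<notin> {1..T} \<Longrightarrow> f t = 0"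
  obtains v where "v \<in> period_space T" "\<And>t. v \<cdot> t = f t"
proof
  have "finite {t. f t \<noteq> 0}"
    by (rule finite_subset[of _ "{1..T}"]) (use assms in blast, simp)
  then show f: "Abs_poly_mapping f \<cdot> t = f t" for t
    by simp
  show "Abs_poly_mapping f \<in> period_space T"
    unfolding period_space_iff f using assms by blast
qed

section \<open>Criticality as separation of sub-extreme periods\<close>

text \<open>Consecutive elements of \<open>E\<close> bound intervals that are open on the left and
  closed on the right, so an element of \<open>E\<close> equal to the earlier of two points already
  separates them, while one equal to the later point does not. This gives the asymmetric condition
  \<open>t \<le> r \<and> r < t'\<close>.\<close>

lemma interval_partition_separation_iff:
  fixes E S :: "nat set"
  assumes fin: "finite E" and zero: "0 \<in> E" and S: "S \<subseteq> {1..T}"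
  defines "ts \<equiv> sorted_list_of_set E"
  shows "(\<forall>I\<in>{{ts ! (i - 1)<..ts ! i} | i. 1 \<le> i \<and> i < length ts}. card (S \<inter> I) \<le> 1) \<and>
           S \<inter> {last ts<..T} = {} \<longleftrightarrow>
         (\<forall>t\<in>S. \<forall>t'\<in>S. t < t' \<longrightarrow> (\<exists>r\<in>E. t \<le> r \<and> r < t')) \<and> (\<forall>t\<in>S. \<exists>r\<in>E. t \<le> r)"
    (is "?L \<and> ?M \<longleftrightarrow> ?A \<and> ?B")
proof -
  have set_ts: "set ts = E" and sorted: "sorted_wrt (<) ts"
    using fin by (auto simp: ts_def)
  have mono: "ts ! i < ts ! j \<longleftrightarrow> i < j" if "i < length ts" "j < length ts" for i j
    using sorted that by (metis linorder_neqE_nat order_less_asym sorted_wrt_nth_less)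
  have index: "\<exists>j<length ts. r = ts ! j" if "r \<in> E" for r
    using that unfolding set_ts[symmetric] in_set_conv_nth by blast
  have ne: "ts \<noteq> []"
    using set_ts zero by auto
  have last_in: "last ts \<in> E"
    using ne set_ts last_in_set by blast
  have le_last: "r \<le> last ts" if "r \<in> E" for r
  proof -
    obtain j where j: "j < length ts" "r = ts ! j"
      using index[OF \<open>r \<in> E\<close>] by blast
    then have "\<not> ts ! (length ts - 1) < ts ! j"
      using mono[of "length ts - 1" j] by auto
    then show ?thesis
      using j ne by (simp add: last_conv_nth)
  qed
  have B: "?M \<longleftrightarrow> ?B"
  proof
    assume M: ?M
    show ?B
    proof
      fix t assume "t \<in> S"
      then have "t \<notin> {last ts<..T}" "t \<le> T"
        using M S by auto
      then show "\<exists>r\<in>E. t \<le> r"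
        using last_in by (intro bexI[of _ "last ts"]) auto
    qed
  next
    assume ?B
    then have "t \<le> last ts" if "t \<in> S" for t
      using that le_last by (meson le_trans)
    then show ?M
      by fastforce
  qed
  \<comment> \<open>Two points of \<open>S\<close> beyond \<open>last ts\<close> lie in none of the
    listed intervals, so \<open>?L\<close> would miss them although \<open>?A\<close> fails. Hence
    the equivalence is claimed only under \<open>?B\<close>.\<close>
  have "?L \<longleftrightarrow> ?A" if b: ?B
  proof
    assume L: ?L
    show ?A
    proof (intro ballI impI, rule ccontr)
      fix t t' assume t: "t \<in> S" "t' \<in> S" "t < t'" and none: "\<not> (\<exists>r\<in>E. t \<le> r \<and> r < t')"
      have ex: "\<exists>i. i < length ts \<and> t' \<le> ts ! i"
        using b t(2) index by blast
      \<comment> \<open>The element \<open>ts ! i\<close> closes the interval that contains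
        \<open>t'\<close>. Its predecessor lies before \<open>t'\<close>, hence before
        \<open>t\<close> by \<open>none\<close>, so \<open>t\<close> falls into the same interval.
        The predecessor exists because \<open>0\<close> belongs to \<open>E\<close> and
        \<open>t'\<close> is positive.\<close>
      define i where "i = (LEAST i. i < length ts \<and> t' \<le> ts ! i)"
      have i: "i < length ts" "t' \<le> ts ! i"
        using LeastI_ex[OF ex] by (auto simp: i_def)
      have "i \<noteq> 0"
      proof
        assume "i = 0"
        obtain j where j: "j < length ts" "0 = ts ! j"
          using index[OF zero] by blast
        then show False
          using mono[of 0 j] i t(3) \<open>i = 0\<close> by (cases "j = 0") auto
      qed
      then have "\<not> t' \<le> ts ! (i - 1)"
        using not_less_Least[of "i - 1" "\<lambda>i. i < length ts \<and> t' \<le> ts ! i"] i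
        by (auto simp: i_def[symmetric])
      moreover have "ts ! (i - 1) \<in> E"
        unfolding set_ts[symmetric] using i by (intro nth_mem) auto
      ultimately have "ts ! (i - 1) < t"
        using none by (meson not_le)
      then have "{t, t'} \<subseteq> S \<inter> {ts ! (i - 1)<..ts ! i}"
        using t i by auto
      then have "card {t, t'} \<le> card (S \<inter> {ts ! (i - 1)<..ts ! i})"
        by (intro card_mono) auto
      also have "\<dots> \<le> 1"
        using \<open>i \<noteq> 0\<close> i(1) by (intro L[rule_format] CollectI exI[of _ i]) simp
      finally show False
        using t by simp
    qed
  next
    assume A: ?A
    show ?L
    proof
      fix I assume "I \<in> {{ts ! (i - 1)<..ts ! i} | i. 1 \<le> i \<and> i < length ts}"
      then obtain i where i: "I = {ts ! (i - 1)<..ts ! i}" "1 \<le> i" "i < length ts"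
        by blast
      have False if "t \<in> S \<inter> I" "t' \<in> S \<inter> I" "t < t'" for t t'
      proof -
        obtain r where r: "r \<in> E" "t \<le> r" "r < t'"
          using A \<open>t \<in> S \<inter> I\<close> \<open>t' \<in> S \<inter> I\<close> \<open>t < t'\<close> by blast
        then obtain j where j: "j < length ts" "r = ts ! j"
          using index by blast
        have "ts ! (i - 1) < ts ! j" "ts ! j < ts ! i"
          using r j that i by auto
        moreover have "i - 1 < length ts"
          using i by simp
        ultimately have "i - 1 < j" "j < i"
          using mono i(3) j(1) by blast+
        then show False
          by simp
      qed
      then have "\<forall>t\<in>S \<inter> I. \<forall>t'\<in>S \<inter> I. t = t'"
        by (metis linorder_neqE_nat)
      moreover have "finite (S \<inter> I)"
        unfolding i(1) by simp
      ultimately show "card (S \<inter> I) \<le> 1"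
        unfolding One_nat_def using card_le_Suc0_iff_eq by blast
    qed
  qed
  with B show ?thesis by blast
qed

text \<open>Both inclusions work with this form of criticality, so the enumeration of intervals by
  list indices is left behind here.\<close>

lemma critical_points_iff:
  "p \<in> critical_points D w z \<longleftrightarrow> p \<in> Q D w z \<and>
     (\<forall>t\<in>subextreme_periods D w z p. \<forall>t'\<in>subextreme_periods D w z p.
        t < t' \<longrightarrow> (\<exists>r\<in>extreme_periods D p. t \<le> r \<and> r < t')) \<and>
     (\<forall>t\<in>subextreme_periods D w z p. \<exists>r\<in>extreme_periods D p. t \<le> r)"
proof -
  have "finite (extreme_periods D p)" "0 \<in> extreme_periods D p"
    "subextreme_periods D w z p \<subseteq> {1..horizon D}"
    by (auto simp: extreme_periods_def subextreme_periods_def periods_def split: prod.splits)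
  from interval_partition_separation_iff[OF this] show ?thesis
    by (simp add: critical_points_def extreme_intervals_def last_interval_def
        extreme_period_list_def Let_def)
qed

section \<open>A convex relaxation of \<open>Q\<close>\<close>

text \<open>The bounds are written as membership in closed intervals, so that convexity of an
  interval handles all three families of bounds at once.\<close>

definition relaxation ::
  "stock_data \<Rightarrow> (nat \<Rightarrow> nat) \<Rightarrow> (nat \<Rightarrow> nat) \<Rightarrow> (rvec \<times> rvec \<times> rvec) set" where
  "relaxation D w z = {(x, y, s).
     x \<in> period_space (horizon D) \<and> y \<in> period_space (horizon D) \<and> s \<in> period_space (horizon D) \<and>
     (\<forall>t\<in>periods D.
        stock D s t = stock D s (t - 1) - y \<cdot> t + x \<cdot> t \<and>
        s \<cdot> t \<in> {Ls D t..Us D t} \<and>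
        y \<cdot> t \<in> {switched z (Ly D) t..switched z (Uy D) t} \<and>
        x \<cdot> t \<in> {switched w (Lx D) t..switched w (Ux D) t})}"

lemma Q_subset_relaxation: "Q D w z \<subseteq> relaxation D w z"
  by (auto simp: Q_def relaxation_def)

text \<open>The initial stock is a constant and not a coordinate of \<open>s\<close>, so
  \<open>stock\<close> is affine rather than linear in \<open>s\<close>; the weights have to sum to
  one for period \<open>0\<close>.\<close>

lemma stock_convex_combination:
  assumes "u + v = 1"
  shows "stock D (u *\<^sub>R s + v *\<^sub>R s') t = u * stock D s t + v * stock D s' t"
proof (cases "t = 0")
  case True
  have "u * init_stock D + v * init_stock D = (u + v) * init_stock D"
    by (simp only: distrib_right)
  with True assms show ?thesis
    by (simp add: stock_def)
qed (simp add: stock_def lookup_add lookup_scaleR)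

lemma convex_relaxation: "convex (relaxation D w z)"
proof (rule convexI)
  fix a b and u v :: real
  assume a: "a \<in> relaxation D w z" and b: "b \<in> relaxation D w z"
    and uv: "0 \<le> u" "0 \<le> v" "u + v = 1"
  obtain x y s x' y' s' where ab: "a = (x, y, s)" "b = (x', y', s')"
    by (metis prod_cases3)
  have box: "u * c + v * d \<in> {l..h}" if "c \<in> {l..h}" "d \<in> {l..h}" for c d l h :: real
    using convexD[OF convex_closed_interval[of l h] that uv] by (simp add: cbox_interval)
  have "stock D (u *\<^sub>R s + v *\<^sub>R s') t = stock D (u *\<^sub>R s + v *\<^sub>R s') (t - 1)
      - (u *\<^sub>R y + v *\<^sub>R y') \<cdot> t + (u *\<^sub>R x + v *\<^sub>R x') \<cdot> t" if "t \<in> periods D" for t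
  proof -
    have eqs: "stock D s t = stock D s (t - 1) - y \<cdot> t + x \<cdot> t"
      "stock D s' t = stock D s' (t - 1) - y' \<cdot> t + x' \<cdot> t"
      using a b that by (auto simp: ab relaxation_def)
    show ?thesis
      unfolding stock_convex_combination[OF uv(3)] lookup_add lookup_scaleR eqs
      by (simp add: algebra_simps)
  qed
  then show "u *\<^sub>R a + v *\<^sub>R b \<in> relaxation D w z"
    using a b unfolding ab relaxation_def
    by (auto simp: period_space_iff lookup_add lookup_scaleR
        simp del: atLeastAtMost_iff intro!: box)
qed

lemma P_subset_relaxation: "P D w z \<subseteq> relaxation D w z"
  unfolding P_def by (intro hull_minimal Q_subset_relaxation convex_relaxation)

section \<open>Critical points are extreme\<close>

text \<open>The distances of \<open>a\<close> and \<open>b\<close> to the attained bound are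
  nonnegative and have a weighted sum of zero with positive weights, so both vanish.\<close>

lemma eq_endpoints_if_combination_at_bound:
  fixes a b u l h :: real
  assumes "0 < u" "u < 1" "a \<in> {l..h}" "b \<in> {l..h}" "(1 - u) * a + u * b \<in> {l, h}"
  shows "a = b"
proof -
  have *: "(1 - u) * (a - l) + u * (b - l) = ((1 - u) * a + u * b) - l"
    "(1 - u) * (h - a) + u * (h - b) = h - ((1 - u) * a + u * b)"
    by (simp_all add: algebra_simps)
  have "(1 - u) * (a - l) \<ge> 0" "u * (b - l) \<ge> 0" "(1 - u) * (h - a) \<ge> 0" "u * (h - b) \<ge> 0"
    using assms by auto
  with * assms(5) have "((1 - u) * (a - l) = 0 \<and> u * (b - l) = 0) \<or>
      ((1 - u) * (h - a) = 0 \<and> u * (h - b) = 0)"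
    by (metis add_nonneg_eq_0_iff diff_self insertE singletonD)
  then show ?thesis
    using assms by auto
qed

text \<open>In the application \<open>d\<close> is the difference of two stocks and \<open>e\<close>
  the difference of the net flows, with \<open>S\<close> the sub-extreme and \<open>E\<close> the
  stock-extreme periods.\<close>

lemma cumulative_eq_0_if_separated:
  fixes d e :: "nat \<Rightarrow> real"
  assumes d0: "d 0 = 0" and step: "\<And>t. t \<in> {1..T} \<Longrightarrow> d t = d (t - 1) + e t"
    and e: "\<And>t. t \<in> {1..T} \<Longrightarrow> t \<notin> S \<Longrightarrow> e t = 0"
    and d: "\<And>r. r \<in> E \<Longrightarrow> d r = 0" and E: "E \<subseteq> {0..T}"
    and sep: "\<And>t t'. t \<in> S \<Longrightarrow> t' \<in> S \<Longrightarrow> t < t' \<Longrightarrow> \<exists>r\<in>E. t \<le> r \<and> r < t'"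
    and fol: "\<And>t. t \<in> S \<Longrightarrow> \<exists>r\<in>E. t \<le> r"
    and t: "t \<le> T"
  shows "d t = 0"
  using t
proof (induction t)
  case 0
  show ?case by (rule d0)
next
  case (Suc t)
  show ?case
  proof (cases "Suc t \<in> S")
    case False
    then show ?thesis
      using Suc step[of "Suc t"] e[of "Suc t"] by simp
  next
    case True
    define r where "r = (LEAST r. r \<in> E \<and> Suc t \<le> r)"
    have r: "r \<in> E" "Suc t \<le> r"
      using LeastI_ex[of "\<lambda>r. r \<in> E \<and> Suc t \<le> r"] fol[OF True] by (auto simp: r_def)
    have least: "r \<le> k" if "k \<in> E" "Suc t \<le> k" for k
      unfolding r_def by (rule Least_le) (use that in auto)
    have "k \<le> r \<longrightarrow> d k = d (Suc t)" if "Suc t \<le> k" for k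
      using that
    proof (induction k rule: dec_induct)
      case base
      show ?case by simp
    next
      case (step k)
      show ?case
      proof
        assume k: "Suc k \<le> r"
        have "Suc k \<notin> S"
          using sep[OF True, of "Suc k"] least k step.hyps by fastforce
        moreover have "Suc k \<in> {1..T}"
          using k r E by auto
        ultimately show "d (Suc k) = d (Suc t)"
          using step.IH k e[of "Suc k"] assms(2)[of "Suc k"] by simp
      qed
    qed
    from this[OF r(2)] show ?thesis
      using d[OF r(1)] by simp
  qed
qed

lemma critical_point_extreme_of_relaxation:
  assumes nonneg: "\<forall>t\<in>periods D. 0 \<le> Lx D t \<and> 0 \<le> Ly D t"
    and crit: "p \<in> critical_points D w z"
  shows "p extreme_point_of (relaxation D w z)"
  unfolding extreme_point_of_def
proof (intro conjI ballI notI)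
  have pQ: "p \<in> Q D w z"
    using crit by (simp add: critical_points_iff)
  then show "p \<in> relaxation D w z"
    using Q_subset_relaxation by blast
  fix a b assume a: "a \<in> relaxation D w z" and b: "b \<in> relaxation D w z"
    and "p \<in> open_segment a b"
  then obtain u where "a \<noteq> b" and u: "0 < u" "u < 1" and pu: "p = (1 - u) *\<^sub>R a + u *\<^sub>R b"
    by (auto simp: in_segment)
  obtain xa ya sa xb yb sb where ab: "a = (xa, ya, sa)" "b = (xb, yb, sb)"
    by (metis prod_cases3)
  obtain x y s where p: "p = (x, y, s)"
    by (metis prod_cases3)
  have xt: "x \<cdot> t = (1 - u) * xa \<cdot> t + u * xb \<cdot> t"
    and yt: "y \<cdot> t = (1 - u) * ya \<cdot> t + u * yb \<cdot> t"
    and st: "s \<cdot> t = (1 - u) * sa \<cdot> t + u * sb \<cdot> t" for t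
    using pu by (auto simp: p ab lookup_add lookup_scaleR)
  have T: "periods D = {1..horizon D}"
    by (simp add: periods_def)
  define d where "d t = stock D sa t - stock D sb t" for t
  define e where "e t = (xa \<cdot> t - ya \<cdot> t) - (xb \<cdot> t - yb \<cdot> t)" for t
  have step: "d t = d (t - 1) + e t" if "t \<in> periods D" for t
    using a b that by (auto simp: ab relaxation_def d_def e_def)
  have "d t = 0" if "t \<le> horizon D" for t
  proof (rule cumulative_eq_0_if_separated[where S = "subextreme_periods D w z p"
        and E = "extreme_periods D p", OF _ _ _ _ _ _ _ that])
    show "d 0 = 0"
      by (simp add: d_def stock_def)
    show "d t = d (t - 1) + e t" if "t \<in> {1..horizon D}" for t
      using step that T by simp
    show "e t = 0" if t: "t \<in> {1..horizon D}" "t \<notin> subextreme_periods D w z p" for t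
    proof -
      have "t \<in> periods D"
        using t T by simp
      then have "x \<cdot> t \<in> {switched w (Lx D) t, switched w (Ux D) t}"
        "y \<cdot> t \<in> {switched z (Ly D) t, switched z (Uy D) t}"
        using pQ t(2) by (fastforce simp: Q_def p subextreme_periods_def)+
      moreover have "xa \<cdot> t \<in> {switched w (Lx D) t..switched w (Ux D) t}"
        "xb \<cdot> t \<in> {switched w (Lx D) t..switched w (Ux D) t}"
        "ya \<cdot> t \<in> {switched z (Ly D) t..switched z (Uy D) t}"
        "yb \<cdot> t \<in> {switched z (Ly D) t..switched z (Uy D) t}"
        using a b \<open>t \<in> periods D\<close> by (auto simp: ab relaxation_def)
      ultimately have "xa \<cdot> t = xb \<cdot> t" "ya \<cdot> t = yb \<cdot> t"
        unfolding xt yt using eq_endpoints_if_combination_at_bound[OF u] by blast+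
      then show ?thesis
        by (simp add: e_def)
    qed
    show "d r = 0" if "r \<in> extreme_periods D p" for r
    proof (cases "r = 0")
      case False
      then have "r \<in> periods D" "s \<cdot> r \<in> {Ls D r, Us D r}"
        using that by (auto simp: p extreme_periods_def)
      moreover from this have "sa \<cdot> r \<in> {Ls D r..Us D r}" "sb \<cdot> r \<in> {Ls D r..Us D r}"
        using a b by (auto simp: ab relaxation_def)
      ultimately have "sa \<cdot> r = sb \<cdot> r"
        unfolding st using eq_endpoints_if_combination_at_bound[OF u] by blast
      then show ?thesis
        by (simp add: d_def stock_def)
    qed (simp add: d_def stock_def)
    show "extreme_periods D p \<subseteq> {0..horizon D}"
      by (auto simp: p extreme_periods_def T)
  qed (use crit in \<open>auto simp: critical_points_iff\<close>)
  then have d: "d t = 0" if "t \<in> insert 0 (periods D)" for t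
    using that T by auto
  have "xa \<cdot> t = xb \<cdot> t \<and> ya \<cdot> t = yb \<cdot> t \<and> sa \<cdot> t = sb \<cdot> t" for t
  proof (cases "t \<in> periods D")
    case True
    \<comment> \<open>For \<open>t = 1\<close> the previous period is \<open>0\<close>, where
      \<open>d\<close> vanishes because both stocks start from \<open>init_stock D\<close>.\<close>
    have "t - 1 \<in> insert 0 (periods D)"
      using True T by auto
    then have e0: "e t = 0"
      using d[of t] d[of "t - 1"] step[of t] True by simp
    have low: "0 \<le> switched w (Lx D) t" "0 \<le> switched z (Ly D) t"
      using nonneg True by (auto simp: switched_def)
    have bds: "switched w (Lx D) t \<le> xa \<cdot> t" "switched w (Lx D) t \<le> xb \<cdot> t"
      "switched z (Ly D) t \<le> ya \<cdot> t" "switched z (Ly D) t \<le> yb \<cdot> t"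
      using a b True by (auto simp: ab relaxation_def)
    \<comment> \<open>Zero is the lower end of the interval from \<open>0\<close> to
      \<open>max c c'\<close>, which contains both values.\<close>
    have zero: "c = c'" if "0 \<le> c" "0 \<le> c'" "(1 - u) * c + u * c' = 0" for c c'
      by (rule eq_endpoints_if_combination_at_bound[OF u, where l = 0 and h = "max c c'"])
        (use that in auto)
    \<comment> \<open>Whichever of the two flows vanishes at \<open>p\<close> also vanishes at
      \<open>a\<close> and \<open>b\<close>; equality of the other flow then follows from equal net
      flows.\<close>
    have "x \<cdot> t = 0 \<or> y \<cdot> t = 0"
      using pQ True by (auto simp: p Q_def)
    then have "xa \<cdot> t = xb \<cdot> t \<or> ya \<cdot> t = yb \<cdot> t"
      using zero[of "xa \<cdot> t" "xb \<cdot> t"] zero[of "ya \<cdot> t" "yb \<cdot> t"] low bds xt[of t] yt[of t]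
      by fastforce
    moreover have "sa \<cdot> t = sb \<cdot> t"
      using d[of t] True T by (auto simp: d_def stock_def)
    ultimately show ?thesis
      using e0 by (auto simp: e_def)
  next
    case False
    then show ?thesis
      using a b T by (auto simp: ab relaxation_def period_space_iff)
  qed
  then have "a = b"
    by (auto simp: ab intro: poly_mapping_eqI)
  with \<open>a \<noteq> b\<close> show False by simp
qed

lemma extreme_point_of_subset:
  assumes "p extreme_point_of S" "S' \<subseteq> S" "p \<in> S'"
  shows "p extreme_point_of S'"
  using assms unfolding extreme_point_of_def by blast

section \<open>Extreme points are critical\<close>

text \<open>A coordinate that does not move may sit on a bound; one that moves starts in the open
  interval. The filter \<open>nhds 0\<close> covers both signs of the step and lets the finitely
  many constraints be combined.\<close>

lemma eventually_perturbation_in_bounds: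
  fixes a c l h :: real
  assumes "a \<in> {l..h}" "c \<noteq> 0 \<Longrightarrow> l < a \<and> a < h"
  shows "\<forall>\<^sub>F \<epsilon> in nhds 0. a + \<epsilon> * c \<in> {l..h}"
proof (cases "c = 0")
  case False
  have "((\<lambda>\<epsilon>. a + \<epsilon> * c) \<longlongrightarrow> a + 0 * c) (nhds 0)"
    by (intro tendsto_intros filterlim_ident)
  then have "\<forall>\<^sub>F \<epsilon> in nhds 0. a + \<epsilon> * c \<in> {l<..<h}"
    using assms(2)[OF False] by (intro topological_tendstoD) auto
  then show ?thesis
    by eventually_elim auto
qed (use assms in simp)

text \<open>The triple of \<open>u\<close>, \<open>v\<close> and \<open>g\<close> is a direction
  along which the point can move both ways inside \<open>Q\<close> itself. By \<open>compl\<close>,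
  in each period at most one flow moves, and only where the other is zero and stays zero, so the
  products remain zero.\<close>

lemma not_extreme_point_if_perturbable:
  fixes u v g :: "nat \<Rightarrow> real"
  assumes pQ: "(x, y, s) \<in> Q D w z"
    and supp: "\<And>t. t \<notin> periods D \<Longrightarrow> u t = 0 \<and> v t = 0 \<and> g t = 0"
    and bal: "\<And>t. t \<in> periods D \<Longrightarrow> g t = g (t - 1) - v t + u t"
    and compl: "\<And>t. t \<in> periods D \<Longrightarrow> (u t \<noteq> 0 \<longrightarrow> y \<cdot> t = 0 \<and> v t = 0) \<and> (v t \<noteq> 0 \<longrightarrow> x \<cdot> t = 0 \<and> u t = 0)"
    and u: "\<And>t. t \<in> periods D \<Longrightarrow> u t \<noteq> 0 \<Longrightarrow> switched w (Lx D) t < x \<cdot> t \<and> x \<cdot> t < switched w (Ux D) t"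
    and v: "\<And>t. t \<in> periods D \<Longrightarrow> v t \<noteq> 0 \<Longrightarrow> switched z (Ly D) t < y \<cdot> t \<and> y \<cdot> t < switched z (Uy D) t"
    and g: "\<And>t. t \<in> periods D \<Longrightarrow> g t \<noteq> 0 \<Longrightarrow> Ls D t < s \<cdot> t \<and> s \<cdot> t < Us D t"
    and nz: "g k \<noteq> 0"
  shows "\<not> (x, y, s) extreme_point_of (P D w z)"
proof
  assume ext: "(x, y, s) extreme_point_of (P D w z)"
  have supp': "u t = 0" "v t = 0" "g t = 0" if "t \<notin> {1..horizon D}" for t
    using supp that by (simp_all add: periods_def)
  obtain u' where u': "u' \<in> period_space (horizon D)" "\<And>t. u' \<cdot> t = u t"
    using ex_vector_with_entries[of "horizon D" u] supp'(1) by blast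
  obtain v' where v': "v' \<in> period_space (horizon D)" "\<And>t. v' \<cdot> t = v t"
    using ex_vector_with_entries[of "horizon D" v] supp'(2) by blast
  obtain g' where g': "g' \<in> period_space (horizon D)" "\<And>t. g' \<cdot> t = g t"
    using ex_vector_with_entries[of "horizon D" g] supp'(3) by blast
  note ps = u'(1) v'(1) g'(1) and lk = u'(2) v'(2) g'(2)
  have fin: "finite (periods D)"
    by (simp add: periods_def)
  have bnd: "s \<cdot> t \<in> {Ls D t..Us D t}" "y \<cdot> t \<in> {switched z (Ly D) t..switched z (Uy D) t}"
    "x \<cdot> t \<in> {switched w (Lx D) t..switched w (Ux D) t}" if "t \<in> periods D" for t
    using pQ that by (auto simp: Q_def)
  have "\<forall>\<^sub>F \<epsilon> in nhds 0. \<forall>t\<in>periods D. s \<cdot> t + \<epsilon> * g t \<in> {Ls D t..Us D t} \<and>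
      y \<cdot> t + \<epsilon> * v t \<in> {switched z (Ly D) t..switched z (Uy D) t} \<and>
      x \<cdot> t + \<epsilon> * u t \<in> {switched w (Lx D) t..switched w (Ux D) t}"
    by (intro eventually_ball_finite fin ballI eventually_conj eventually_perturbation_in_bounds)
      (use bnd u v g in auto)
  then obtain \<delta> where "\<delta> > 0" and \<delta>: "\<And>\<epsilon>. \<bar>\<epsilon>\<bar> < \<delta> \<Longrightarrow> \<forall>t\<in>periods D. s \<cdot> t + \<epsilon> * g t \<in> {Ls D t..Us D t} \<and>
      y \<cdot> t + \<epsilon> * v t \<in> {switched z (Ly D) t..switched z (Uy D) t} \<and>
      x \<cdot> t + \<epsilon> * u t \<in> {switched w (Lx D) t..switched w (Ux D) t}"
    unfolding eventually_nhds_metric dist_real_def diff_0_right by metis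
  define q where "q \<epsilon> = (x, y, s) + \<epsilon> *\<^sub>R (u', v', g')" for \<epsilon>
  have qQ: "q \<epsilon> \<in> Q D w z" if "\<bar>\<epsilon>\<bar> < \<delta>" for \<epsilon>
  proof -
    \<comment> \<open>At \<open>t = 0\<close> this needs \<open>g 0 = 0\<close>, which
      \<open>supp\<close> supplies since \<open>0\<close> is not a period.\<close>
    have st: "stock D (s + \<epsilon> *\<^sub>R g') t = stock D s t + \<epsilon> * g t" for t
      using supp[of 0] by (auto simp: stock_def lookup_add lookup_scaleR lk periods_def)
    have "stock D (s + \<epsilon> *\<^sub>R g') t = stock D (s + \<epsilon> *\<^sub>R g') (t - 1)
        - (y + \<epsilon> *\<^sub>R v') \<cdot> t + (x + \<epsilon> *\<^sub>R u') \<cdot> t" if "t \<in> periods D" for t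
    proof -
      have "stock D s t = stock D s (t - 1) - y \<cdot> t + x \<cdot> t"
        using pQ that by (auto simp: Q_def)
      then show ?thesis
        unfolding st lookup_add lookup_scaleR lk bal[OF that] by (simp add: algebra_simps)
    qed
    moreover have "(x + \<epsilon> *\<^sub>R u') \<cdot> t * (y + \<epsilon> *\<^sub>R v') \<cdot> t = 0" if "t \<in> periods D" for t
      using pQ that compl[OF that] by (fastforce simp: Q_def lookup_add lookup_scaleR lk)
    moreover have "x + \<epsilon> *\<^sub>R u' \<in> period_space (horizon D)" "y + \<epsilon> *\<^sub>R v' \<in> period_space (horizon D)"
      "s + \<epsilon> *\<^sub>R g' \<in> period_space (horizon D)"
      using pQ ps by (auto simp: Q_def period_space_iff lookup_add lookup_scaleR)
    ultimately show ?thesis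
      using \<delta>[OF that] by (auto simp: q_def Q_def lookup_add lookup_scaleR lk)
  qed
  have QP: "Q D w z \<subseteq> P D w z"
    by (simp add: P_def hull_subset)
  have "q (\<delta> / 2) \<in> P D w z" "q (- \<delta> / 2) \<in> P D w z"
    using qQ[of "\<delta> / 2"] qQ[of "- \<delta> / 2"] \<open>\<delta> > 0\<close> QP by auto
  moreover have "(x, y, s) \<in> open_segment (q (\<delta> / 2)) (q (- \<delta> / 2))"
  proof -
    have "(x, y, s) = midpoint (q (\<delta> / 2)) (q (- \<delta> / 2))"
      by (simp add: midpoint_def q_def scaleR_2[symmetric] del: scaleR_Pair)
    moreover have "q (\<delta> / 2) \<noteq> q (- \<delta> / 2)"
    proof
      assume "q (\<delta> / 2) = q (- \<delta> / 2)"
      then have "(s + (\<delta> / 2) *\<^sub>R g') \<cdot> k = (s + (- \<delta> / 2) *\<^sub>R g') \<cdot> k"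
        unfolding q_def by (simp only: scaleR_Pair add_Pair prod.inject)
      then show False
        using nz \<open>\<delta> > 0\<close> unfolding lookup_add lookup_scaleR lk by simp
    qed
    ultimately show ?thesis
      by simp
  qed
  ultimately show False
    using ext unfolding extreme_point_of_def by blast
qed

text \<open>
  Taking \<open>t' = horizon D + 1\<close> covers the last interval: then the shifted stock is never
  compensated within the horizon.
\<close>

lemma not_extreme_point_if_unseparated:
  assumes nonneg: "\<forall>t\<in>periods D. 0 \<le> Lx D t \<and> 0 \<le> Ly D t"
    and pQ: "p \<in> Q D w z"
    and t: "t \<in> subextreme_periods D w z p"
    and t': "t' \<in> insert (Suc (horizon D)) (subextreme_periods D w z p)"
    and less: "t < t'"
    and none: "\<And>r. r \<in> extreme_periods D p \<Longrightarrow> t \<le> r \<Longrightarrow> t' \<le> r"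
  shows "\<not> p extreme_point_of (P D w z)"
proof -
  obtain x y s where p: "p = (x, y, s)"
    by (metis prod_cases3)
  \<comment> \<open>\<open>X\<close> records whether the inflow can absorb the change in a period;
    otherwise the outflow has to, and then with the opposite sign, as it lowers the stock.\<close>
  define X where "X k \<longleftrightarrow> switched w (Lx D) k < x \<cdot> k \<and> x \<cdot> k < switched w (Ux D) k" for k
  define g where "g k = (if t \<le> k \<and> k < t' then 1 else 0 :: real)" for k
  \<comment> \<open>One unit of net flow is added at \<open>t\<close> and taken back at
    \<open>t'\<close>, so \<open>g\<close> is the resulting stock change. The guard drops the second
    change when \<open>t'\<close> is \<open>Suc (horizon D)\<close>.\<close>
  define e where "e k = (if k = t then 1 else if k = t' \<and> k \<in> periods D then -1 else 0 :: real)" for k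
  define u where "u k = (if X k then e k else 0)" for k
  define v where "v k = (if X k then 0 else - e k)" for k
  have tp: "t \<in> periods D" and t'_le: "t' \<le> Suc (horizon D)"
    using t t' by (auto simp: p subextreme_periods_def periods_def)
  have Y: "switched z (Ly D) k < y \<cdot> k \<and> y \<cdot> k < switched z (Uy D) k" if "e k \<noteq> 0" "\<not> X k" for k
    using that t t' by (auto simp: e_def p subextreme_periods_def X_def periods_def split: if_splits)
  have low: "0 \<le> switched w (Lx D) k" "0 \<le> switched z (Ly D) k" if "k \<in> periods D" for k
    using nonneg that by (auto simp: switched_def)
  have xy: "x \<cdot> k = 0 \<or> y \<cdot> k = 0" if "k \<in> periods D" for k
    using pQ that by (auto simp: p Q_def)
  show ?thesis
    unfolding p
  proof (rule not_extreme_point_if_perturbable[of x y s D w z u v g t])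
    show "(x, y, s) \<in> Q D w z"
      using pQ p by simp
    show "u k = 0 \<and> v k = 0 \<and> g k = 0" if "k \<notin> periods D" for k
      using that tp t'_le by (auto simp: u_def v_def g_def e_def periods_def)
    show "g k = g (k - 1) - v k + u k" if "k \<in> periods D" for k
      using that less tp t'_le by (auto simp: u_def v_def g_def e_def periods_def)
    show "(u k \<noteq> 0 \<longrightarrow> y \<cdot> k = 0 \<and> v k = 0) \<and> (v k \<noteq> 0 \<longrightarrow> x \<cdot> k = 0 \<and> u k = 0)"
      if "k \<in> periods D" for k
      \<comment> \<open>A flow that changes lies strictly above a nonnegative lower bound, so it is
        positive and the other flow is zero.\<close>
      using low[OF that] xy[OF that] Y[of k] by (auto simp: u_def v_def X_def)
    show "switched w (Lx D) k < x \<cdot> k \<and> x \<cdot> k < switched w (Ux D) k" if "u k \<noteq> 0" for k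
      using that by (auto simp: u_def X_def split: if_splits)
    show "switched z (Ly D) k < y \<cdot> k \<and> y \<cdot> k < switched z (Uy D) k" if "v k \<noteq> 0" for k
      using that Y by (auto simp: v_def split: if_splits)
    show "Ls D k < s \<cdot> k \<and> s \<cdot> k < Us D k" if "k \<in> periods D" "g k \<noteq> 0" for k
    proof -
      have "k \<notin> extreme_periods D p"
        using none[of k] that(2) by (auto simp: g_def split: if_splits)
      moreover have "Ls D k \<le> s \<cdot> k" "s \<cdot> k \<le> Us D k"
        using pQ that(1) by (auto simp: p Q_def)
      ultimately show ?thesis
        using that(1) by (auto simp: p extreme_periods_def)
    qed
    show "g t \<noteq> 0"
      using less by (simp add: g_def)
  qed
qed

section \<open>Both inclusions combined\<close>

theorem theorem1:
  fixes D :: stock_data and w z :: "nat \<Rightarrow> nat"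
  assumes "horizon D \<ge> 1"
    and "\<forall>t\<in>periods D. 0 \<le> Ls D t \<and> 0 \<le> Us D t \<and> 0 \<le> Lx D t \<and> 0 \<le> Ux D t \<and>
                         0 \<le> Ly D t \<and> 0 \<le> Uy D t"
    and "\<forall>t\<in>periods D. w t \<in> {0, 1} \<and> z t \<in> {0, 1}"
  shows "{p. p extreme_point_of (P D w z)} = critical_points D w z"
proof (intro subset_antisym subsetI)
  have nonneg: "\<forall>t\<in>periods D. 0 \<le> Lx D t \<and> 0 \<le> Ly D t"
    using assms(2) by blast
  fix p
  {
    assume "p \<in> {p. p extreme_point_of (P D w z)}"
    then have ext: "p extreme_point_of (P D w z)" by simp
    \<comment> \<open>An extreme point of a convex hull belongs to the generating set.\<close>
    then have pQ: "p \<in> Q D w z"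
      unfolding P_def by (rule extreme_point_of_convex_hull)
    note contra = not_extreme_point_if_unseparated[OF nonneg pQ, THEN notE, OF _ _ _ _ ext]
    have "\<exists>r\<in>extreme_periods D p. t \<le> r \<and> r < t'"
      if "t \<in> subextreme_periods D w z p" "t' \<in> subextreme_periods D w z p" "t < t'" for t t'
      using contra[of t t'] that by (meson insertI2 not_le)
    moreover have "\<exists>r\<in>extreme_periods D p. t \<le> r" if "t \<in> subextreme_periods D w z p" for t
    proof -
      have "t < Suc (horizon D)"
        using that by (auto simp: subextreme_periods_def periods_def split: prod.splits)
      then show ?thesis
        \<comment> \<open>If no stock-extreme period follows \<open>t\<close>, the hypothesis on
          periods between \<open>t\<close> and \<open>Suc (horizon D)\<close> holds
          vacuously.\<close>
        using contra[of t "Suc (horizon D)"] that by blast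
    qed
    ultimately show "p \<in> critical_points D w z"
      using pQ by (simp add: critical_points_iff)
  next
    assume crit: "p \<in> critical_points D w z"
    then have "p \<in> P D w z"
      unfolding P_def by (simp add: critical_points_iff hull_inc)
    \<comment> \<open>Extremality passes from the larger set \<open>relaxation D w z\<close> to its
      subset \<open>P D w z\<close>, as the point lies in the latter.\<close>
    with critical_point_extreme_of_relaxation[OF nonneg crit] P_subset_relaxation
    have "p extreme_point_of (P D w z)"
      by (rule extreme_point_of_subset)
    then show "p \<in> {p. p extreme_point_of (P D w z)}"
      by simp
  }
qed

end
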